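(* Let $a_0,d_0$ be coprime integers with $1 \le a_0 < d_0$, let $\langle A(a_0,d_0), A(a_1,d_1), \ldots \rangle$ be the sequence of arithmetic progressions $\mathfrak{S}(a_0,d_0)$, and let $\langle A(a_0,d_0), A(a_1,d_1), \ldots, A(a_\beta,d_\beta)\rangle$ (with $\beta \ge 1$) be its first grouping, with second common difference $\triangle$. Then $a_i = a_{\beta-i}$ for all $0 \le i \le \beta$ if and only if $\triangle$ divides $d_0^2 - 1$.
   Context: $A(x,y)$ denotes the arithmetic progression with leading term $x$ and common difference $y$. For coprime positive integers $a_0,d_0$, the sequence $\mathfrak{S}(a_0,d_0)$ is the finite sequence of distinct progressions $A(a_0,d_0), A(a_1,d_1), \ldots$ in which each consecutive pair satisfies $(a_k+jd_k)(a_{k+1}+jd_{k+1}) \equiv 1 \pmod{a_k+(j+1)d_k}$ for all $j\ge 0$, and $d_k \ge d_{k+1} \ge 1$. Explicitly: if $d_k = 1$ the sequence stops at $A(a_k,d_k)$; otherwise $d_{k+1}$ is the unique integer with $1 \le d_{k+1} < d_k$ and $a_k d_{k+1} \equiv 1 \pmod{d_k}$, and $a_{k+1} = d_{k+1} + \frac{a_k d_{k+1} - 1}{d_k}$. A grouping is a run $A(a_\alpha,d_\alpha),\ldots,A(a_\beta,d_\beta)$ of at least two consecutive progressions of the sequence such that $d_r - d_{r+1}$ equals a common value $\triangle$ (the second common difference) for all $\alpha \le r \le \beta-1$, and which is maximal with this property. The first grouping is the grouping with $\alpha = 0$, i.e. the maximal initial run $A(a_0,d_0),\ldots,A(a_\beta,d_\beta)$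 with $d_0-d_1 = d_1-d_2 = \cdots = d_{\beta-1}-d_\beta = \triangle$. The condition $a_i = a_{\beta-i}$ for all $0\le i\le\beta$ is what the paper calls symmetricity of the (leading terms of the) first grouping. *)

theory Defs
  imports "HOL-Number_Theory.Cong"
begin

text \<open>
  The arithmetic progression \<open>A(a, d)\<close> is represented by the pair \<open>(a, d)\<close> of its leading term
  and its common difference.
\<close>

type_synonym progression = "int \<times> int"

definition next_progression :: "progression \<Rightarrow> progression \<Rightarrow> bool" where
  "next_progression P Q \<longleftrightarrow>
     1 \<le> snd Q \<and> snd Q < snd P \<and> [fst P * snd Q = 1] (mod snd P) \<and>
     fst Q = snd Q + (fst P * snd Q - 1) div snd P"

definition progression_seq :: "int \<Rightarrow> int \<Rightarrow> progression list \<Rightarrow> bool" where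
  "progression_seq a\<^sub>0 d\<^sub>0 S \<longleftrightarrow>
     S \<noteq> [] \<and> hd S = (a\<^sub>0, d\<^sub>0) \<and>
     (\<forall>k. Suc k < length S \<longrightarrow> next_progression (S ! k) (S ! Suc k)) \<and>
     snd (last S) = 1"

definition constant_second_difference ::
    "progression list \<Rightarrow> nat \<Rightarrow> nat \<Rightarrow> int \<Rightarrow> bool" where
  "constant_second_difference S \<alpha> \<beta> \<Delta> \<longleftrightarrow>
     \<alpha> < \<beta> \<and> \<beta> < length S \<and>
     (\<forall>r. \<alpha> \<le> r \<and> r < \<beta> \<longrightarrow> snd (S ! r) - snd (S ! Suc r) = \<Delta>)"

definition grouping :: "progression list \<Rightarrow> nat \<Rightarrow> nat \<Rightarrow> int \<Rightarrow> bool" where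
  "grouping S \<alpha> \<beta> \<Delta> \<longleftrightarrow>
     constant_second_difference S \<alpha> \<beta> \<Delta> \<and>
     (\<forall>\<alpha>' \<beta>' \<Delta>'. \<alpha>' \<le> \<alpha> \<and> \<beta> \<le> \<beta>' \<and> constant_second_difference S \<alpha>' \<beta>' \<Delta>'
        \<longrightarrow> \<alpha>' = \<alpha> \<and> \<beta>' = \<beta>)"

definition first_grouping :: "progression list \<Rightarrow> nat \<Rightarrow> int \<Rightarrow> bool" where
  "first_grouping S \<beta> \<Delta> \<longleftrightarrow> grouping S 0 \<beta> \<Delta>"

text \<open>
  The explicit step agrees with the defining congruences between consecutive, distinct
  progressions; in particular a progression with common difference 1 has no successor.
\<close>

lemma next_progression_iff_cong:
  fixes a d a' d' :: int
  assumes "d \<ge> 1"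
  shows "next_progression (a, d) (a', d') \<longleftrightarrow>
    1 \<le> d' \<and> d' \<le> d \<and> (a', d') \<noteq> (a, d) \<and>
    (\<forall>j::nat. [(a + int j * d) * (a' + int j * d') = 1] (mod (a + (int j + 1) * d)))"
    (is "?L \<longleftrightarrow> ?R")
proof
  assume L: ?L
  define q where "q = (a * d' - 1) div d"
  from L have "d dvd a * d' - 1"
    by (simp add: next_progression_def cong_iff_dvd_diff)
  then have e: "a * d' = 1 + d * q" by (simp add: q_def)
  have a': "a' = d' + q" using L by (simp add: next_progression_def q_def)
  have "(a + int j * d) * (a' + int j * d') - 1
      = (a + (int j + 1) * d) * (a' + int j * d' - d')" for j :: nat
    unfolding a' using e by algebra
  then have "[(a + int j * d) * (a' + int j * d') = 1] (mod (a + (int j + 1) * d))" for j :: nat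
    unfolding cong_iff_dvd_diff by simp
  with L show ?R by (auto simp: next_progression_def)
next
  assume R: ?R
  define C where "C = a * d' - 1 - d * (a' - d')"
  have dv: "a + (int j + 1) * d dvd C" for j :: nat
  proof -
    have "a + (int j + 1) * d dvd (a + int j * d) * (a' + int j * d') - 1"
      using R unfolding cong_iff_dvd_diff by blast
    moreover have "C = (a + int j * d) * (a' + int j * d') - 1
        - (a + (int j + 1) * d) * (a' + int j * d' - d')"
      unfolding C_def by (simp add: algebra_simps)
    ultimately show ?thesis by (metis dvd_diff dvd_triv_left)
  qed
  define j where "j = nat (\<bar>a\<bar> + \<bar>C\<bar>)"
  have "int j = \<bar>a\<bar> + \<bar>C\<bar>" by (simp add: j_def)
  then have "\<bar>C\<bar> < a + (int j + 1) * 1" by simp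
  also have "\<dots> \<le> a + (int j + 1) * d"
    by (intro add_left_mono mult_left_mono) (use assms in auto)
  finally have "\<bar>C\<bar> < a + (int j + 1) * d" .
  moreover have "\<bar>a + (int j + 1) * d\<bar> \<le> \<bar>C\<bar>" if "C \<noteq> 0"
    using that dv by (rule dvd_imp_le_int)
  ultimately have "C = 0" by (meson abs_ge_self leD order_trans)
  then have e: "a * d' - 1 = d * (a' - d')" by (simp add: C_def)
  have "d' \<noteq> d"
  proof
    assume "d' = d"
    then have "d * (a - (a' - d')) = 1" using e by (simp add: algebra_simps)
    then have "d = 1" using assms pos_zmult_eq_1_iff[of d] by simp
    then show False using R e \<open>d' = d\<close> by auto
  qed
  with R e assms show ?L
    by (auto simp: next_progression_def cong_iff_dvd_diff)
qed

lemma next_progression_ex1: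
  fixes a d :: int
  assumes "coprime a d" "d > 1"
  shows "\<exists>!Q. next_progression (a, d) Q"
proof (rule ex_ex1I)
  obtain x where x: "[a * x = 1] (mod d)"
    using assms(1) cong_solve_coprime_int by blast
  define e where "e = x mod d"
  have c: "[a * e = 1] (mod d)"
    using x by (simp add: e_def cong_def mod_mult_right_eq)
  have "e \<noteq> 0" using c assms(2) by (auto simp: cong_def)
  moreover have "0 \<le> e" "e < d" using assms(2) by (auto simp: e_def)
  ultimately have "next_progression (a, d) (e + (a * e - 1) div d, e)"
    using c by (simp add: next_progression_def)
  then show "\<exists>Q. next_progression (a, d) Q" ..
next
  fix P Q
  assume P: "next_progression (a, d) P" and Q: "next_progression (a, d) Q"
  then have "[a * snd P = a * snd Q] (mod d)"
    unfolding next_progression_def by (metis cong_sym cong_trans fst_conv snd_conv)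
  then have "[snd P = snd Q] (mod d)"
    using assms(1) cong_mult_lcancel by blast
  then have "snd P = snd Q"
    using P Q by (auto simp: next_progression_def cong_def)
  then show "P = Q"
    using P Q by (auto simp: next_progression_def prod_eq_iff)
qed

lemma next_progression_coprime:
  assumes "next_progression (a, d) (a', d')"
  shows "coprime a' d'"
proof -
  define q where "q = (a * d' - 1) div d"
  from assms have "d dvd a * d' - 1"
    by (simp add: next_progression_def cong_iff_dvd_diff)
  then have e: "a * d' = 1 + d * q" by (simp add: q_def)
  have a': "a' = d' + q" using assms by (simp add: next_progression_def q_def)
  show ?thesis
  proof (rule coprimeI)
    fix c assume c: "c dvd a'" "c dvd d'"
    then have "c dvd q" unfolding a' by (metis dvd_add_right_iff)
    with c have "c dvd a * d' - d * q" by simp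
    with e show "c dvd 1" by simp
  qed
qed

lemma progression_seq_single: "progression_seq a d [P] \<longleftrightarrow> P = (a, d) \<and> d = 1"
  by (auto simp: progression_seq_def)

lemma progression_seq_Cons:
  assumes "S \<noteq> []"
  shows "progression_seq a d (P # S) \<longleftrightarrow>
    P = (a, d) \<and> next_progression P (hd S) \<and> progression_seq (fst (hd S)) (snd (hd S)) S"
proof -
  have "(\<forall>k. Suc k < length (P # S) \<longrightarrow> next_progression ((P # S) ! k) ((P # S) ! Suc k)) \<longleftrightarrow>
      next_progression P (hd S) \<and>
      (\<forall>k. Suc k < length S \<longrightarrow> next_progression (S ! k) (S ! Suc k))" (is "?A \<longleftrightarrow> ?B")
  proof
    assume A: ?A
    have "next_progression P (hd S)"
      using A[rule_format, of 0] assms by (simp add: hd_conv_nth)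
    moreover have "next_progression (S ! k) (S ! Suc k)" if "Suc k < length S" for k
      using A[rule_format, of "Suc k"] that by simp
    ultimately show ?B by blast
  next
    assume B: ?B
    show ?A
    proof (intro allI impI)
      fix k assume "Suc k < length (P # S)"
      then show "next_progression ((P # S) ! k) ((P # S) ! Suc k)"
        using B assms by (cases k) (simp_all add: hd_conv_nth)
    qed
  qed
  then show ?thesis
    using assms unfolding progression_seq_def by auto
qed

lemma progression_seq_ex1:
  fixes a d :: int
  assumes "coprime a d" "d \<ge> 1"
  shows "\<exists>!S. progression_seq a d S"
  using assms
proof (induction "nat d" arbitrary: a d rule: less_induct)
  case less
  show ?case
  proof (cases "d = 1")
    case True
    have "S = [(a, d)]" if S: "progression_seq a d S" for S
    proof (cases S)
      case Nil
      with S show ?thesis by (simp add: progression_seq_def)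
    next
      case (Cons P T)
      have "T = []"
      proof (rule ccontr)
        assume "T \<noteq> []"
        then have "next_progression (a, d) (hd T)"
          using S by (auto simp: Cons progression_seq_Cons)
        with True show False by (auto simp: next_progression_def)
      qed
      with S Cons show ?thesis by (simp add: progression_seq_single)
    qed
    moreover have "progression_seq a d [(a, d)]"
      using True by (simp add: progression_seq_single)
    ultimately show ?thesis by (intro ex1I)
  next
    case False
    with less.prems have d: "d > 1" by simp
    obtain a' d' where Q: "next_progression (a, d) (a', d')"
      and uniq: "\<And>R. next_progression (a, d) R \<Longrightarrow> R = (a', d')"
      using next_progression_ex1[OF less.prems(1) d] by (metis surj_pair)
    have "coprime a' d'" using Q by (rule next_progression_coprime)
    moreover have "d' \<ge> 1" "d' < d" using Q by (auto simp: next_progression_def)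
    ultimately obtain T where T: "progression_seq a' d' T"
      and T_uniq: "\<And>U. progression_seq a' d' U \<Longrightarrow> U = T"
      using less.hyps[of d' a'] by auto
    have T': "T \<noteq> []" "hd T = (a', d')" using T by (auto simp: progression_seq_def)
    show ?thesis
    proof (rule ex1I)
      show "progression_seq a d ((a, d) # T)"
        using T T' Q by (simp add: progression_seq_Cons)
    next
      fix S assume S: "progression_seq a d S"
      then obtain P U where PU: "S = P # U"
        by (cases S) (auto simp: progression_seq_def)
      have "U \<noteq> []"
        using S False by (auto simp: PU progression_seq_single)
      with S have P: "P = (a, d)" and next_U: "next_progression (a, d) (hd U)"
        and seq_U: "progression_seq (fst (hd U)) (snd (hd U)) U"
        by (auto simp: PU progression_seq_Cons)
      have "hd U = (a', d')" using next_U by (rule uniq)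
      with seq_U have "U = T" by (intro T_uniq) simp
      with P PU show "S = (a, d) # T" by simp
    qed
  qed
qed

end

theory Submission
  imports Defs
begin

text \<open>
  Along a run with constant second difference \<open>\<Delta>\<close>, the number \<open>\<Delta> * a\<^sub>k + 1\<close> stays a multiple of
  \<open>d\<^sub>k\<close>, and its cofactor grows by \<open>\<Delta>\<close> in each step. Hence
  \<open>\<Delta> * a\<^sub>k + 1 = (d\<^sub>0 - k * \<Delta>) * (m + k * \<Delta>)\<close> with \<open>m = (\<Delta> * a\<^sub>0 + 1) / d\<^sub>0\<close>, a quadratic in \<open>k\<close>
  that is symmetric under \<open>k \<mapsto> \<beta> - k\<close> iff \<open>d\<^sub>0 - m = \<beta> * \<Delta>\<close>. Because \<open>d\<^sub>k\<close> divides
  \<open>\<Delta> * a\<^sub>k + 1\<close>, the run can only end when \<open>d\<^sub>k \<le> \<Delta>\<close>, so \<open>d\<^sub>0 - \<beta> * \<Delta>\<close> is the representative of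
  \<open>d\<^sub>0\<close> modulo \<open>\<Delta>\<close> in \<open>{1..\<Delta>}\<close>. As \<open>1 \<le> m \<le> \<Delta>\<close>, symmetry means \<open>\<Delta> dvd d\<^sub>0 - m\<close>, which is
  \<open>\<Delta> dvd d\<^sub>0\<^sup>2 - 1\<close> since \<open>d\<^sub>0 * m\<close> is congruent to 1 modulo \<open>\<Delta>\<close>.
\<close>

lemma next_progression_eq:
  assumes "next_progression (a, d) (a', d')"
  shows "a' * d = a * d' + d * d' - 1"
proof -
  have "d dvd a * d' - 1" and "a' = d' + (a * d' - 1) div d"
    using assms by (simp_all add: next_progression_def cong_iff_dvd_diff)
  then show ?thesis by (auto simp: algebra_simps elim!: dvdE)
qed

text \<open>After multiplication by \<open>d\<close>, the new leading term is eliminated by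
  \<open>next_progression_eq\<close> and the old one by the cofactor equation; then \<open>d\<close>
  cancels.\<close>

lemma next_progression_cofactor:
  assumes "next_progression (a, d) (a', d')" and "d - d' = \<Delta>" and "\<Delta> * a + 1 = d * m"
  shows "\<Delta> * a' + 1 = d' * (m + \<Delta>)"
proof -
  have "a' * d = a * d' + d * d' - 1" using assms(1) by (rule next_progression_eq)
  then have "d * (\<Delta> * a' + 1) = d * (d' * (m + \<Delta>))"
    using assms(2,3) by algebra
  moreover have "d \<noteq> 0" using assms(1) by (auto simp: next_progression_def)
  ultimately show ?thesis by simp
qed

text \<open>Since \<open>d'\<close> is congruent to \<open>-\<Delta>\<close> modulo
  \<open>d\<close>, the inverse condition on \<open>d'\<close> says that \<open>d\<close> divides
  \<open>\<Delta> * a + 1\<close>. This starts the induction along the run.\<close>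

lemma next_progression_first_cofactor:
  assumes "next_progression (a, d) (a', d')" and "d - d' = \<Delta>"
  obtains m where "\<Delta> * a + 1 = d * m"
proof
  have "a' * d = a * d' + d * d' - 1" using assms(1) by (rule next_progression_eq)
  then show "\<Delta> * a + 1 = d * (a + d' - a')"
    using assms(2) by algebra
qed

text \<open>The cofactor equation makes \<open>-\<Delta>\<close> an inverse of \<open>a\<close>
  modulo \<open>d\<close>, so \<open>d - \<Delta>\<close>, lying strictly between 0 and
  \<open>d\<close>, is the only possible next difference.\<close>

lemma next_progression_continue:
  assumes "coprime a d" and "\<Delta> * a + 1 = d * m" and "0 < \<Delta>" and "\<Delta> < d"
    and "next_progression (a, d) Q"
  shows "d - snd Q = \<Delta>"
proof -
  have "a * (d - \<Delta>) - 1 = d * (a - m)"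
    using assms(2) by algebra
  then have "next_progression (a, d) (d - \<Delta> + (a * (d - \<Delta>) - 1) div d, d - \<Delta>)"
    using assms(3,4) by (simp add: next_progression_def cong_iff_dvd_diff)
  moreover have "\<exists>!Q. next_progression (a, d) Q"
    using assms(1,3,4) by (intro next_progression_ex1) auto
  ultimately have "Q = (d - \<Delta> + (a * (d - \<Delta>) - 1) div d, d - \<Delta>)"
    using assms(5) by blast
  then show ?thesis by simp
qed

lemma constant_second_difference_terms:
  assumes "progression_seq a d S" and "constant_second_difference S 0 \<beta> \<Delta>"
    and "\<Delta> * a + 1 = d * m" and "k \<le> \<beta>"
  shows "snd (S ! k) = d - int k * \<Delta> \<and>
    \<Delta> * fst (S ! k) + 1 = (d - int k * \<Delta>) * (m + int k * \<Delta>)"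
  using assms(4)
proof (induction k)
  case 0
  have "S ! 0 = (a, d)"
    using assms(1) by (auto simp: progression_seq_def hd_conv_nth)
  then show ?case using assms(3) by simp
next
  case (Suc k)
  have step: "next_progression (fst (S ! k), snd (S ! k)) (fst (S ! Suc k), snd (S ! Suc k))"
    and diff: "snd (S ! k) - snd (S ! Suc k) = \<Delta>"
    using assms(1,2) Suc.prems
    by (auto simp: progression_seq_def constant_second_difference_def)
  have "\<Delta> * fst (S ! k) + 1 = snd (S ! k) * (m + int k * \<Delta>)"
    using Suc by simp
  with step diff have "\<Delta> * fst (S ! Suc k) + 1 = snd (S ! Suc k) * ((m + int k * \<Delta>) + \<Delta>)"
    by (rule next_progression_cofactor)
  moreover have "snd (S ! Suc k) = d - int (Suc k) * \<Delta>"
    using Suc diff by (simp add: algebra_simps)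
  ultimately show ?case by (simp add: algebra_simps)
qed

text \<open>Otherwise the sequence does not stop at \<open>\<beta>\<close>, and
  \<open>next_progression_continue\<close> lengthens the run, against maximality.\<close>

lemma first_grouping_last_le:
  assumes "coprime a d" and S: "progression_seq a d S" and grp: "first_grouping S \<beta> \<Delta>"
    and m: "\<Delta> * a + 1 = d * m" and "0 < \<Delta>"
  shows "snd (S ! \<beta>) \<le> \<Delta>"
proof (rule ccontr)
  assume "\<not> snd (S ! \<beta>) \<le> \<Delta>"
  then have gt: "\<Delta> < snd (S ! \<beta>)" by simp
  have csd: "constant_second_difference S 0 \<beta> \<Delta>"
    using grp by (simp add: first_grouping_def grouping_def)
  then have \<beta>: "0 < \<beta>" "\<beta> < length S"
    by (simp_all add: constant_second_difference_def)
  have step: "next_progression (S ! k) (S ! Suc k)" if "Suc k < length S" for k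
    using S that by (simp add: progression_seq_def)
  have "snd (S ! (length S - 1)) = 1"
    using S by (auto simp: progression_seq_def last_conv_nth)
  then have "\<beta> \<noteq> length S - 1" using gt \<open>0 < \<Delta>\<close> by auto
  then have len: "Suc \<beta> < length S" using \<beta> by simp
  have "coprime (fst (S ! \<beta>)) (snd (S ! \<beta>))"
    using step[of "\<beta> - 1"] \<beta>
    by (intro next_progression_coprime[of "fst (S ! (\<beta> - 1))" "snd (S ! (\<beta> - 1))"]) simp
  moreover have "\<Delta> * fst (S ! \<beta>) + 1 = snd (S ! \<beta>) * (m + int \<beta> * \<Delta>)"
    using constant_second_difference_terms[OF S csd m order_refl] by simp
  ultimately have "snd (S ! \<beta>) - snd (S ! Suc \<beta>) = \<Delta>"
    using step[OF len] gt \<open>0 < \<Delta>\<close> by (intro next_progression_continue) auto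
  with csd len have "constant_second_difference S 0 (Suc \<beta>) \<Delta>"
    by (auto simp: constant_second_difference_def less_Suc_eq)
  moreover have "\<beta> \<le> Suc \<beta>" by simp
  ultimately show False
    using grp unfolding first_grouping_def grouping_def by (metis le_refl n_not_Suc_n)
qed

theorem theorem1:
  fixes a\<^sub>0 d\<^sub>0 \<Delta> :: int and \<beta> :: nat and S :: "progression list"
  assumes "coprime a\<^sub>0 d\<^sub>0" and "1 \<le> a\<^sub>0" and "a\<^sub>0 < d\<^sub>0"
    and "progression_seq a\<^sub>0 d\<^sub>0 S"
    and "first_grouping S \<beta> \<Delta>"
  shows "(\<forall>i\<le>\<beta>. fst (S ! i) = fst (S ! (\<beta> - i))) \<longleftrightarrow> \<Delta> dvd d\<^sub>0\<^sup>2 - 1"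
proof -
  have csd: "constant_second_difference S 0 \<beta> \<Delta>"
    using assms(5) by (simp add: first_grouping_def grouping_def)
  then have \<beta>: "0 < \<beta>" "\<beta> < length S" and diff0: "snd (S ! 0) - snd (S ! 1) = \<Delta>"
    by (auto simp: constant_second_difference_def)
  have step: "next_progression (S ! k) (S ! Suc k)" if "Suc k < length S" for k
    using assms(4) that by (simp add: progression_seq_def)
  have S0: "S ! 0 = (a\<^sub>0, d\<^sub>0)"
    using assms(4) by (auto simp: progression_seq_def hd_conv_nth)
  have S01: "next_progression (a\<^sub>0, d\<^sub>0) (fst (S ! 1), snd (S ! 1))"
    using step[of 0] \<beta> S0 by simp
  with diff0 have "0 < \<Delta>" by (auto simp: next_progression_def S0)
  obtain m where m: "\<Delta> * a\<^sub>0 + 1 = d\<^sub>0 * m"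
    using next_progression_first_cofactor[OF S01] diff0 S0 by auto
  note terms = constant_second_difference_terms[OF assms(4) csd m]
  have "0 < d\<^sub>0" using assms(2,3) by simp
  \<comment> \<open>The lower bound on \<open>m\<close> comes from \<open>1 \<le> a\<^sub>0\<close>,
    the upper one from \<open>a\<^sub>0 < d\<^sub>0\<close>.\<close>
  have "0 < d\<^sub>0 * m" using m \<open>0 < \<Delta>\<close> assms(2) by (smt (verit) mult_pos_pos)
  then have "0 < m" using \<open>0 < d\<^sub>0\<close> by (simp add: zero_less_mult_iff)
  have "\<Delta> * a\<^sub>0 \<le> \<Delta> * (d\<^sub>0 - 1)" using assms(3) \<open>0 < \<Delta>\<close> by simp
  then have "d\<^sub>0 * m \<le> d\<^sub>0 * \<Delta>" using m \<open>0 < \<Delta>\<close> by (simp add: algebra_simps)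
  then have "m \<le> \<Delta>" using \<open>0 < d\<^sub>0\<close> by simp
  have d\<beta>_le: "d\<^sub>0 - int \<beta> * \<Delta> \<le> \<Delta>"
    using first_grouping_last_le[OF assms(1,4,5) m \<open>0 < \<Delta>\<close>] terms[of \<beta>] by simp
  have d\<beta>_pos: "0 < d\<^sub>0 - int \<beta> * \<Delta>"
    using step[of "\<beta> - 1"] \<beta> terms[of \<beta>] by (auto simp: next_progression_def)
  have sym_eq: "\<Delta> * (fst (S ! i) - fst (S ! (\<beta> - i))) =
      (int \<beta> - 2 * int i) * \<Delta> * (m - (d\<^sub>0 - int \<beta> * \<Delta>))" if "i \<le> \<beta>" for i
  proof -
    have "int (\<beta> - i) = int \<beta> - int i" using that by simp
    moreover have "\<Delta> * fst (S ! i) + 1 = (d\<^sub>0 - int i * \<Delta>) * (m + int i * \<Delta>)"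
      "\<Delta> * fst (S ! (\<beta> - i)) + 1 = (d\<^sub>0 - int (\<beta> - i) * \<Delta>) * (m + int (\<beta> - i) * \<Delta>)"
      using terms that by simp_all
    ultimately show ?thesis by algebra
  qed
  have "(\<forall>i\<le>\<beta>. fst (S ! i) = fst (S ! (\<beta> - i))) \<longleftrightarrow> m = d\<^sub>0 - int \<beta> * \<Delta>"
  proof
    assume "\<forall>i\<le>\<beta>. fst (S ! i) = fst (S ! (\<beta> - i))"
    \<comment> \<open>The index 0 suffices: there the factor \<open>int \<beta> - 2 * int i\<close>
      is nonzero.\<close>
    then have "fst (S ! 0) - fst (S ! (\<beta> - 0)) = 0" by (metis diff_self zero_le)
    then have "int \<beta> * \<Delta> * (m - (d\<^sub>0 - int \<beta> * \<Delta>)) = 0"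
      using sym_eq[of 0] by simp
    then show "m = d\<^sub>0 - int \<beta> * \<Delta>" using \<beta> \<open>0 < \<Delta>\<close> by simp
  next
    assume "m = d\<^sub>0 - int \<beta> * \<Delta>"
    then have "\<Delta> * (fst (S ! i) - fst (S ! (\<beta> - i))) = 0" if "i \<le> \<beta>" for i
      using sym_eq[OF that] by simp
    then show "\<forall>i\<le>\<beta>. fst (S ! i) = fst (S ! (\<beta> - i))"
      using \<open>0 < \<Delta>\<close> by (metis eq_iff_diff_eq_0 less_irrefl mult_eq_0_iff)
  qed
  also have "\<dots> \<longleftrightarrow> \<Delta> dvd d\<^sub>0 - m"
  proof
    assume "\<Delta> dvd d\<^sub>0 - m"
    then have "\<Delta> dvd (d\<^sub>0 - m) - int \<beta> * \<Delta>" by (rule dvd_diff) simp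
    \<comment> \<open>Both \<open>m\<close> and \<open>d\<^sub>0 - int \<beta> * \<Delta>\<close>
      lie in \<open>{1..\<Delta>}\<close>, so they differ by less than \<Delta>.\<close>
    moreover have "\<bar>(d\<^sub>0 - m) - int \<beta> * \<Delta>\<bar> < \<bar>\<Delta>\<bar>"
      using \<open>0 < m\<close> \<open>m \<le> \<Delta>\<close> d\<beta>_le d\<beta>_pos by linarith
    ultimately have "(d\<^sub>0 - m) - int \<beta> * \<Delta> = 0" by (meson dvd_imp_le_int not_le)
    then show "m = d\<^sub>0 - int \<beta> * \<Delta>" by simp
  qed simp
  also have "\<dots> \<longleftrightarrow> \<Delta> dvd d\<^sub>0 * (d\<^sub>0 - m)"
  proof -
    \<comment> \<open>The equation for \<open>m\<close> doubles as a Bezout identity for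
      \<open>d\<^sub>0\<close> and \<Delta>.\<close>
    have "d\<^sub>0 * m + \<Delta> * (- a\<^sub>0) = 1" using m by simp
    then have "coprime \<Delta> d\<^sub>0"
      by (metis coprimeI dvd_add dvd_mult2)
    then show ?thesis by (simp add: coprime_dvd_mult_right_iff)
  qed
  also have "d\<^sub>0 * (d\<^sub>0 - m) = (d\<^sub>0\<^sup>2 - 1) + \<Delta> * (- a\<^sub>0)"
    using m by (simp add: power2_eq_square algebra_simps)
  also have "\<Delta> dvd \<dots> \<longleftrightarrow> \<Delta> dvd d\<^sub>0\<^sup>2 - 1"
    by (rule dvd_add_left_iff) simp
  finally show ?thesis .
qed

end
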